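(* Let $\mathcal S$ be an order $n$ asymptotically stable discrete-time single-input single-output linear system with transfer function $H$, let $\mathbb U\in\mathbb R^{T+1}$ be an input to $\mathcal S$ and $\mathbb Y\in\mathbb R^{T+1}$ the corresponding output, and let $\sigma\in\mathbb C$ not be a pole of the system (not an eigenvalue of $\lambda\mathbf E-\mathbf A$). Let $\mathbf U\in\mathbb R^{2(n+1)\times p}$ have orthonormal columns forming a basis of $\operatorname{Range}(\mathbf G_n)$. Assume the three rank conditions $$\operatorname{rank}\begin{bmatrix}\mathbf U & \mathbf z(\sigma) & \mathbf b(\sigma)\end{bmatrix}=\operatorname{rank}\begin{bmatrix}\mathbf U & \mathbf z(\sigma)\end{bmatrix},\qquad \operatorname{rank}\begin{bmatrix}\mathbf U & \mathbf z(\sigma)\end{bmatrix}=\operatorname{rank}(\mathbf U)+1,$$ $$\operatorname{rank}\begin{bmatrix}\mathbf U & \mathbf z(\sigma) & \mathbf b^{(1)}(\sigma)\end{bmatrix}=\operatorname{rank}\begin{bmatrix}\mathbf U & \mathbf z(\sigma)\end{bmatrix}.$$ Decompose $\mathbf z(\sigma)=\mathbf u+\mathbf v$ with $\mathbf u\in\operatorname{Range}(\mathbf U)$ (over $\mathbb C$) and $\mathbf U^{\top}\mathbf v=\mathbf 0$, let $\theta\in(0,\pi/2]$ be the angle between $\mathbf z(\sigma)$ and $\operatorname{Range}(\mathbf U)$, and set $\alpha=\sin\theta=\|\mathbf v\|/\|\mathbf z(\sigma)\|=\|\mathbf v\|/\|\gamma_n(\sigma)\|$. Then there exists a unique $\hat\xi_1\in\mathbb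 C^p$ such that $$\begin{bmatrix}\mathbf U & \mathbf v\end{bmatrix}\begin{bmatrix}\hat\xi_1\\ H'(\sigma)\end{bmatrix}=\begin{bmatrix}\gamma_n^{(1)}(\sigma)\\ H(\sigma)\gamma_n^{(1)}(\sigma)\end{bmatrix},$$ and $$\|\hat\xi_1\|^2+|H'(\sigma)|^2\alpha^2\|\gamma_n(\sigma)\|^2=(1+|H(\sigma)|^2)\|\gamma_n^{(1)}(\sigma)\|^2 .$$ Consequently, if $H'(\sigma)\neq 0$, $$\alpha=\sqrt{\frac{(1+|H(\sigma)|^2)\|\gamma_n^{(1)}(\sigma)\|^2-\|\hat\xi_1\|^2}{|H'(\sigma)|^2\|\gamma_n(\sigma)\|^2}}.$$
   Context: The system $\mathcal S$ is $\mathbf E\mathbf x[k+1]=\mathbf A\mathbf x[k]+\mathbf b u[k]$, $y[k]=\mathbf c^{\top}\mathbf x[k]$, with $\mathbf E,\mathbf A\in\mathbb R^{n\times n}$, $\mathbf E$ nonsingular, $\mathbf b,\mathbf c\in\mathbb R^n$; its transfer function is $H(z)=\mathbf c^{\top}(z\mathbf E-\mathbf A)^{-1}\mathbf b$, and asymptotic stability means all eigenvalues of the pencil $\lambda\mathbf E-\mathbf A$ lie in the open unit disk. $H'$ is the derivative of $H$ with respect to $z$. The data are $\mathbb U=[u[0],\dots,u[T]]^{\top}$ and $\mathbb Y=[y[0],\dots,y[T]]^{\top}$ (a trajectory of $\mathcal S$, for some initial state), with $T\ge n$. For $\mathbb W=[w[0],\dots,w[T]]^\top$, the Hankel matrix $\mathbb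 H_n(\mathbb W)\in\mathbb R^{(n+1)\times(T-n+1)}$ has $(i,j)$ entry $w[i+j]$ for $0\le i\le n$, $0\le j\le T-n$. Set $$\mathbf G_n=\begin{bmatrix}\mathbb H_n(\mathbb U)\\ \mathbb H_n(\mathbb Y)\end{bmatrix}\in\mathbb R^{2(n+1)\times(T-n+1)},$$ $\gamma_n(\sigma)=[1,\sigma,\dots,\sigma^n]^{\top}$, $\gamma_n^{(1)}(\sigma)=[0,1,2\sigma,\dots,n\sigma^{n-1}]^{\top}$, and $$\mathbf z(\sigma)=\begin{bmatrix}\mathbf 0\\ -\gamma_n(\sigma)\end{bmatrix},\quad \mathbf b(\sigma)=\begin{bmatrix}\gamma_n(\sigma)\\ \mathbf 0\end{bmatrix},\quad \mathbf b^{(1)}(\sigma)=\begin{bmatrix}\gamma_n^{(1)}(\sigma)\\ H(\sigma)\gamma_n^{(1)}(\sigma)\end{bmatrix},$$ all in $\mathbb C^{2(n+1)}$, where $\mathbf 0\in\mathbb C^{n+1}$. Norms are Euclidean. (The vector $\mathbf b(\sigma)$ is unrelated to the input vector $\mathbf b$ of the system.) *)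

theory Defs
  imports
    "HOL-Analysis.Analysis"
    "Jordan_Normal_Form.DL_Rank"
    "Jordan_Normal_Form.Gauss_Jordan_Elimination"
    "Jordan_Normal_Form.Conjugate"
begin

(* Vectors and matrices are those of Jordan_Normal_Form throughout; the competing
   Cartesian-product names of HOL-Analysis are hidden. *)
unbundle no vec_syntax
no_notation inner (infix "\<bullet>" 70)
hide_const (open)
  Finite_Cartesian_Product.vec Finite_Cartesian_Product.mat
  Finite_Cartesian_Product.row Finite_Cartesian_Product.column
  Determinants.det

abbreviation cvec :: "real vec \<Rightarrow> complex vec" where
  "cvec \<equiv> map_vec complex_of_real"

abbreviation cmat :: "real mat \<Rightarrow> complex mat" where
  "cmat \<equiv> map_mat complex_of_real"

definition vnorm :: "complex vec \<Rightarrow> real" where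
  "vnorm x = L2_set (\<lambda>i. cmod (x $ i)) {..<dim_vec x}"

definition append_cols :: "'a mat \<Rightarrow> 'a vec list \<Rightarrow> 'a mat" where
  "append_cols M ws = mat_of_cols (dim_row M) (cols M @ ws)"

abbreviation mat_rank :: "'a :: field mat \<Rightarrow> nat" where
  "mat_rank M \<equiv> vec_space.rank (dim_row M) M"

abbreviation mat_range :: "'a :: field mat \<Rightarrow> 'a vec set" where
  "mat_range M \<equiv> vec_space.col_space (dim_row M) M"

(* The angle between a vector and a subspace S is the least angle between it and a
   nonzero w in S. The modulus of the Hermitian product makes this the angle between
   complex lines, so that it lies in [0, pi/2]. *)
definition angle_to_subspace :: "complex vec \<Rightarrow> complex vec set \<Rightarrow> real" where
  "angle_to_subspace x S =
     (INF w \<in> {w \<in> S. w \<noteq> 0\<^sub>v (dim_vec w)}.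
        arccos (cmod (x \<bullet> conjugate w) / (vnorm x * vnorm w)))"

definition siso_system ::
  "nat \<Rightarrow> real mat \<Rightarrow> real mat \<Rightarrow> real vec \<Rightarrow> real vec \<Rightarrow> bool" where
  "siso_system n E A b c \<longleftrightarrow>
     E \<in> carrier_mat n n \<and> A \<in> carrier_mat n n \<and> invertible_mat E \<and>
     b \<in> carrier_vec n \<and> c \<in> carrier_vec n"

definition pencil :: "real mat \<Rightarrow> real mat \<Rightarrow> complex \<Rightarrow> complex mat" where
  "pencil E A z = z \<cdot>\<^sub>m cmat E - cmat A"

definition pencil_eigenvalue :: "real mat \<Rightarrow> real mat \<Rightarrow> complex \<Rightarrow> bool" where
  "pencil_eigenvalue E A \<mu> \<longleftrightarrow>
     (\<exists>x \<in> carrier_vec (dim_row A). x \<noteq> 0\<^sub>v (dim_row A) \<and>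
        pencil E A \<mu> *\<^sub>v x = 0\<^sub>v (dim_row A))"

definition asymptotically_stable :: "real mat \<Rightarrow> real mat \<Rightarrow> bool" where
  "asymptotically_stable E A \<longleftrightarrow> (\<forall>\<mu>. pencil_eigenvalue E A \<mu> \<longrightarrow> cmod \<mu> < 1)"

(* mat_inverse returns an option; it is Some wherever z is not an eigenvalue of the
   pencil, and the value elsewhere is irrelevant. *)
definition transfer_function ::
  "real mat \<Rightarrow> real mat \<Rightarrow> real vec \<Rightarrow> real vec \<Rightarrow> complex \<Rightarrow> complex" where
  "transfer_function E A b c z =
     cvec c \<bullet> (the (mat_inverse (pencil E A z)) *\<^sub>v cvec b)"

(* us, ys hold the samples at times 0..T; the initial state x 0 is unconstrained. *)
definition io_trajectory ::
  "nat \<Rightarrow> real mat \<Rightarrow> real mat \<Rightarrow> real vec \<Rightarrow> real vec \<Rightarrow> nat \<Rightarrow> real vec \<Rightarrow> real vec \<Rightarrow> bool" where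
  "io_trajectory n E A b c T us ys \<longleftrightarrow>
     us \<in> carrier_vec (T + 1) \<and> ys \<in> carrier_vec (T + 1) \<and>
     (\<exists>x :: nat \<Rightarrow> real vec.
        (\<forall>k \<le> T. x k \<in> carrier_vec n) \<and>
        (\<forall>k < T. E *\<^sub>v x (k + 1) = A *\<^sub>v x k + (us $ k) \<cdot>\<^sub>v b) \<and>
        (\<forall>k \<le> T. ys $ k = c \<bullet> x k))"

definition hankel :: "nat \<Rightarrow> nat \<Rightarrow> real vec \<Rightarrow> real mat" where
  "hankel n T ws = mat (n + 1) (T - n + 1) (\<lambda>(i, j). ws $ (i + j))"

definition data_matrix :: "nat \<Rightarrow> nat \<Rightarrow> real vec \<Rightarrow> real vec \<Rightarrow> real mat" where
  "data_matrix n T us ys = hankel n T us @\<^sub>r hankel n T ys"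

definition gam :: "nat \<Rightarrow> complex \<Rightarrow> complex vec" where
  "gam n \<sigma> = vec (n + 1) (\<lambda>i. \<sigma> ^ i)"

definition gam1 :: "nat \<Rightarrow> complex \<Rightarrow> complex vec" where
  "gam1 n \<sigma> = vec (n + 1) (\<lambda>i. of_nat i * \<sigma> ^ (i - 1))"

definition zvec :: "nat \<Rightarrow> complex \<Rightarrow> complex vec" where
  "zvec n \<sigma> = 0\<^sub>v (n + 1) @\<^sub>v (- gam n \<sigma>)"

definition bvec :: "nat \<Rightarrow> complex \<Rightarrow> complex vec" where
  "bvec n \<sigma> = gam n \<sigma> @\<^sub>v 0\<^sub>v (n + 1)"

definition bvec1 :: "nat \<Rightarrow> (complex \<Rightarrow> complex) \<Rightarrow> complex \<Rightarrow> complex vec" where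
  "bvec1 n H \<sigma> = gam1 n \<sigma> @\<^sub>v (H \<sigma> \<cdot>\<^sub>v gam1 n \<sigma>)"

end

theory Submission
  imports Defs
begin

text \<open>The idea is that one linear functional reads off the coefficient of \<open>v\<close>. Put
  \<open>d(z) = det (zE - A)\<close> and \<open>N(z) = c\<^sup>T adj(zE - A) b\<close>, polynomials of degree at most \<open>n\<close> with
  \<open>H = N/d\<close> wherever \<open>d\<close> does not vanish. Cramer's rule over the commutative ring of polynomials
  in the forward shift \<open>S\<close> turns the state equation into \<open>d(S) y = N(S) u\<close>
  (\<open>difference_equation\<close>). Hence the vector \<open>r\<close> made of the coefficients of \<open>N\<close> and of \<open>-d\<close> is
  orthogonal to every column of the data matrix, and so to \<open>Range U\<close>. On the vectors that are
  powers of \<open>\<sigma>\<close> and their derivatives it evaluates polynomials: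
  \<open>r\<close> takes \<open>z(\<sigma>)\<close> to \<open>d(\<sigma>) \<noteq> 0\<close>, and \<open>b\<^sup>(\<^sup>1\<^sup>)(\<sigma>)\<close> to
  \<open>N'(\<sigma>) - H(\<sigma>) d'(\<sigma>)\<close>, which is \<open>H'(\<sigma>) d(\<sigma>)\<close> by the quotient rule
  (\<open>deriv_transfer_function\<close>).

  The rank condition on \<open>b\<^sup>(\<^sup>1\<^sup>)(\<sigma>)\<close> says that this vector is \<open>U a + t z(\<sigma>)\<close> for some \<open>a\<close> and
  \<open>t\<close> (\<open>rank_append_eqE\<close>). Applying \<open>r\<close> gives \<open>t = H'(\<sigma>)\<close>. Writing \<open>z(\<sigma>) = u + v\<close> and
  absorbing \<open>u\<close> into \<open>U a\<close> yields the required solution. Uniqueness and the norm identity are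
  then the orthonormality of the columns of \<open>U\<close> and the theorem of Pythagoras.

  As for the angle, \<open>v\<close> is orthogonal to \<open>Range U\<close>, so by Cauchy-Schwarz the angle to the range is
  \<open>arccos (\<parallel>u\<parallel> / \<parallel>z(\<sigma>)\<parallel>)\<close> (\<open>angle_to_subspace_orthogonal_decomp\<close>), with sine \<open>\<parallel>v\<parallel> / \<parallel>z(\<sigma>)\<parallel>\<close>.
  It is positive because \<open>r\<close> vanishes on \<open>u\<close> but not on \<open>z(\<sigma>)\<close>. The rank condition on \<open>b(\<sigma>)\<close>
  excludes \<open>Range U = 0\<close>, for which the infimum defining the angle would be over the empty set.\<close>

section \<open>Hermitian geometry\<close>

lemma vnorm_power2: "(vnorm x)\<^sup>2 = (\<Sum>i<dim_vec x. (cmod (x $ i))\<^sup>2)"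
  by (simp add: vnorm_def L2_set_def sum_nonneg)

lemma vnorm_nonneg: "0 \<le> vnorm x"
  by (simp add: vnorm_def L2_set_nonneg)

lemma scalar_prod_conjugate_self: "x \<bullet> conjugate x = complex_of_real ((vnorm x)\<^sup>2)"
  unfolding vnorm_power2 scalar_prod_def
  by (simp add: complex_norm_square lessThan_atLeast0 conjugate_complex_def del: of_real_power)

lemma vnorm_pos: "x \<noteq> 0\<^sub>v (dim_vec x) \<Longrightarrow> 0 < vnorm x"
  using scalar_prod_conjugate_self[of x] conjugate_square_eq_0_vec[of x "dim_vec x"] vnorm_nonneg[of x]
  by (auto simp: less_le)

lemma vnorm_Cauchy_Schwarz:
  assumes "dim_vec x = dim_vec y"
  shows "cmod (x \<bullet> conjugate y) \<le> vnorm x * vnorm y"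
proof -
  have "cmod (x \<bullet> conjugate y) \<le> (\<Sum>i<dim_vec y. cmod (x $ i * conjugate y $ i))"
    unfolding scalar_prod_def by (simp add: lessThan_atLeast0 norm_sum)
  also have "\<dots> = (\<Sum>i<dim_vec y. \<bar>cmod (x $ i)\<bar> * \<bar>cmod (y $ i)\<bar>)"
    by (simp add: norm_mult conjugate_complex_def)
  also have "\<dots> \<le> vnorm x * vnorm y"
    unfolding vnorm_def assms by (rule L2_set_mult_ineq)
  finally show ?thesis .
qed

lemma vnorm_add_orthogonal:
  assumes x: "x \<in> carrier_vec N" and y: "y \<in> carrier_vec N" and "y \<bullet> conjugate x = 0"
  shows "(vnorm (x + y))\<^sup>2 = (vnorm x)\<^sup>2 + (vnorm y)\<^sup>2"
proof -
  have "x \<bullet> conjugate y = conjugate (y \<bullet> conjugate x)"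
    using x y by (simp add: scalar_prod_def mult.commute)
  then have xy: "x \<bullet> conjugate y = 0" using assms(3) by simp
  have "complex_of_real ((vnorm (x + y))\<^sup>2) = (x + y) \<bullet> conjugate (x + y)"
    by (simp only: scalar_prod_conjugate_self)
  also have "\<dots> = x \<bullet> conjugate x + y \<bullet> conjugate y"
    using x y xy assms(3)
    by (simp add: conjugate_add_vec add_scalar_prod_distrib[of _ N] scalar_prod_add_distrib[of _ N])
  also have "\<dots> = complex_of_real ((vnorm x)\<^sup>2 + (vnorm y)\<^sup>2)"
    by (simp only: scalar_prod_conjugate_self of_real_add)
  finally show ?thesis by (simp only: of_real_eq_iff)
qed

lemma vnorm_smult: "vnorm (c \<cdot>\<^sub>v x) = cmod c * vnorm x"
  unfolding vnorm_def by (simp add: norm_mult L2_set_right_distrib cong: L2_set_cong_simp)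

lemma vnorm_uminus: "vnorm (- x) = vnorm x"
  unfolding vnorm_def by (rule L2_set_cong) auto

lemma vnorm_append: "(vnorm (x @\<^sub>v y))\<^sup>2 = (vnorm x)\<^sup>2 + (vnorm y)\<^sup>2"
proof -
  have conj: "conjugate (x @\<^sub>v y) = conjugate x @\<^sub>v conjugate y" by (rule eq_vecI) auto
  have "complex_of_real ((vnorm (x @\<^sub>v y))\<^sup>2) = (x @\<^sub>v y) \<bullet> conjugate (x @\<^sub>v y)"
    by (simp only: scalar_prod_conjugate_self)
  also have "\<dots> = x \<bullet> conjugate x + y \<bullet> conjugate y"
    unfolding conj by (rule scalar_prod_append[of _ "dim_vec x" _ "dim_vec y"]) auto
  also have "\<dots> = complex_of_real ((vnorm x)\<^sup>2 + (vnorm y)\<^sup>2)"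
    by (simp only: scalar_prod_conjugate_self of_real_add)
  finally show ?thesis by (simp only: of_real_eq_iff)
qed

text \<open>Only the component \<open>u\<close> in \<open>S\<close> contributes to products with vectors of \<open>S\<close>, so
  Cauchy-Schwarz bounds the cosine by \<open>\<parallel>u\<parallel> / \<parallel>u + v\<parallel>\<close>. The bound is attained at \<open>u\<close> itself unless
  \<open>u = 0\<close>, when any nonzero \<open>w0\<close> attains it.\<close>

lemma angle_to_subspace_orthogonal_decomp:
  assumes S: "S \<subseteq> carrier_vec N" and u: "u \<in> S" and v: "v \<in> carrier_vec N"
    and orth: "\<And>w. w \<in> S \<Longrightarrow> v \<bullet> conjugate w = 0"
    and z: "u + v \<noteq> 0\<^sub>v N" and w0: "w0 \<in> S" "w0 \<noteq> 0\<^sub>v N"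
  shows "angle_to_subspace (u + v) S = arccos (vnorm u / vnorm (u + v))"
    and "sin (angle_to_subspace (u + v) S) = vnorm v / vnorm (u + v)"
proof -
  let ?z = "u + v"
  let ?f = "\<lambda>w. arccos (cmod (?z \<bullet> conjugate w) / (vnorm ?z * vnorm w))"
  let ?X = "?f ` {w \<in> S. w \<noteq> 0\<^sub>v (dim_vec w)}"
  have uN: "u \<in> carrier_vec N" using S u by auto
  have zpos: "0 < vnorm ?z" using vnorm_pos[of ?z] z v uN by auto
  have pyth: "(vnorm ?z)\<^sup>2 = (vnorm u)\<^sup>2 + (vnorm v)\<^sup>2"
    using vnorm_add_orthogonal[OF uN v orth[OF u]] .
  have "(vnorm u)\<^sup>2 \<le> (vnorm ?z)\<^sup>2" using pyth by simp
  then have uz: "vnorm u \<le> vnorm ?z" using zpos by (simp add: power2_le_iff_abs_le vnorm_nonneg)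
  have zw: "?z \<bullet> conjugate w = u \<bullet> conjugate w" if "w \<in> S" for w
    using that S uN v orth[OF that] by (subst add_scalar_prod_distrib[of _ N]) auto
  have lower: "arccos (vnorm u / vnorm ?z) \<le> ?f w" if w: "w \<in> S" "w \<noteq> 0\<^sub>v (dim_vec w)" for w
  proof (rule arccos_le_arccos)
    have "cmod (?z \<bullet> conjugate w) \<le> vnorm u * vnorm w"
      using vnorm_Cauchy_Schwarz[of u w] zw[OF w(1)] uN w S by auto
    then show "cmod (?z \<bullet> conjugate w) / (vnorm ?z * vnorm w) \<le> vnorm u / vnorm ?z"
      using vnorm_pos[OF w(2)] zpos by (simp add: field_simps)
    show "- 1 \<le> cmod (?z \<bullet> conjugate w) / (vnorm ?z * vnorm w)"
      by (rule order_trans[of _ 0]) (auto simp: vnorm_nonneg)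
    show "vnorm u / vnorm ?z \<le> 1" using uz zpos by simp
  qed
  have attained: "arccos (vnorm u / vnorm ?z) \<in> ?X"
  proof (cases "u = 0\<^sub>v N")
    case True
    have "?z \<bullet> conjugate w0 = 0" using zw[OF w0(1)] True w0 S by auto
    moreover have "vnorm u = 0" using True by (simp add: vnorm_def L2_set_def)
    ultimately have "arccos (vnorm u / vnorm ?z) = ?f w0" by simp
    moreover have "w0 \<in> {w \<in> S. w \<noteq> 0\<^sub>v (dim_vec w)}" using w0 S by auto
    ultimately show ?thesis by (rule image_eqI)
  next
    case False
    have "0 < vnorm u" using vnorm_pos[of u] False uN by auto
    then have "vnorm u / vnorm ?z = cmod (?z \<bullet> conjugate u) / (vnorm ?z * vnorm u)"
      unfolding zw[OF u] scalar_prod_conjugate_self by (simp add: power2_eq_square norm_mult)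
    moreover have "u \<in> {w \<in> S. w \<noteq> 0\<^sub>v (dim_vec w)}" using u False uN by auto
    ultimately show ?thesis by auto
  qed
  show angle: "angle_to_subspace ?z S = arccos (vnorm u / vnorm ?z)"
    unfolding angle_to_subspace_def by (rule cInf_eq_minimum[OF attained]) (use lower in auto)
  have "sin (arccos (vnorm u / vnorm ?z)) = sqrt (1 - (vnorm u / vnorm ?z)\<^sup>2)"
  proof (rule sin_arccos)
    show "- 1 \<le> vnorm u / vnorm ?z"
      by (rule order_trans[of _ 0]) (auto simp: vnorm_nonneg)
    show "vnorm u / vnorm ?z \<le> 1" using uz zpos by simp
  qed
  also have "1 - (vnorm u / vnorm ?z)\<^sup>2 = (vnorm v / vnorm ?z)\<^sup>2"
    using zpos by (simp add: power_divide diff_eq_eq add_divide_distrib[symmetric] add.commute flip: pyth)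
  also have "sqrt \<dots> = vnorm v / vnorm ?z"
    by (simp add: vnorm_nonneg)
  finally show "sin (angle_to_subspace ?z S) = vnorm v / vnorm ?z" unfolding angle .
qed

lemma conjugate_cmat_mult:
  assumes "W \<in> carrier_mat N p" "x \<in> carrier_vec p"
  shows "conjugate (cmat W *\<^sub>v x) = cmat W *\<^sub>v conjugate x"
  using assms
  by (intro eq_vecI) (auto simp: scalar_prod_def sum_conjugate conjugate_dist_mul conjugate_complex_def)

text \<open>Conjugation fixes a real matrix, so its plain transpose is also its Hermitian adjoint.
  This is why transposes suffice below although the vectors are complex.\<close>

lemma scalar_prod_cmat_mult_conjugate:
  assumes W: "W \<in> carrier_mat N p" and x: "x \<in> carrier_vec p" and y: "y \<in> carrier_vec N"
  shows "y \<bullet> conjugate (cmat W *\<^sub>v x) = ((cmat W)\<^sup>T *\<^sub>v y) \<bullet> conjugate x"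
  using W x y transpose_vec_mult_scalar[of "cmat W" N p "conjugate x" y]
  by (simp add: conjugate_cmat_mult[OF W x])

lemma cmat_transpose_mult_self:
  assumes W: "W \<in> carrier_mat N p" and "W\<^sup>T * W = 1\<^sub>m p"
  shows "(cmat W)\<^sup>T * cmat W = 1\<^sub>m p"
proof -
  have "(cmat W)\<^sup>T * cmat W = cmat (W\<^sup>T * W)"
    using W by (subst of_real_hom.mat_hom_mult[of _ p N]) (auto simp: map_mat_transpose)
  then show ?thesis using assms(2) by (simp add: of_real_hom.mat_hom_one)
qed

lemma vnorm_cmat_mult:
  assumes W: "W \<in> carrier_mat N p" and I: "W\<^sup>T * W = 1\<^sub>m p" and x: "x \<in> carrier_vec p"
  shows "vnorm (cmat W *\<^sub>v x) = vnorm x"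
proof -
  have "(cmat W)\<^sup>T *\<^sub>v (cmat W *\<^sub>v x) = x"
    using W x by (simp add: assoc_mult_mat_vec[of _ p N _ p, symmetric] cmat_transpose_mult_self[OF W I])
  then have "(cmat W *\<^sub>v x) \<bullet> conjugate (cmat W *\<^sub>v x) = x \<bullet> conjugate x"
    using W x by (subst scalar_prod_cmat_mult_conjugate[OF W x]) auto
  then have "(vnorm (cmat W *\<^sub>v x))\<^sup>2 = (vnorm x)\<^sup>2"
    unfolding scalar_prod_conjugate_self by (simp only: of_real_eq_iff)
  then show ?thesis by (simp add: vnorm_nonneg)
qed

section \<open>Appended columns and rank\<close>

lemma append_cols_carrier:
  "M \<in> carrier_mat N k \<Longrightarrow> append_cols M ws \<in> carrier_mat N (k + length ws)"
  by (auto simp: append_cols_def)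

lemma cols_append_cols:
  assumes "M \<in> carrier_mat N k" "set ws \<subseteq> carrier_vec N"
  shows "cols (append_cols M ws) = cols M @ ws"
  unfolding append_cols_def
  by (rule cols_mat_of_cols) (use assms cols_dim[of M] in auto)

lemma append_cols_append:
  assumes "M \<in> carrier_mat N k" "set ws \<subseteq> carrier_vec N"
  shows "append_cols (append_cols M ws) ws' = append_cols M (ws @ ws')"
  using cols_append_cols[OF assms] unfolding append_cols_def[of "append_cols M ws"]
  by (simp add: append_cols_def)

lemma append_cols_mult:
  fixes M :: "'a :: comm_ring_1 mat"
  assumes M: "M \<in> carrier_mat N k" and w: "w \<in> carrier_vec N" and a: "a \<in> carrier_vec k"
  shows "append_cols M [w] *\<^sub>v (a @\<^sub>v vec_of_list [t]) = M *\<^sub>v a + t \<cdot>\<^sub>v w"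
proof (rule eq_vecI)
  fix i assume "i < dim_vec (M *\<^sub>v a + t \<cdot>\<^sub>v w)"
  then have i: "i < N" using w by auto
  have row: "row (append_cols M [w]) i = row M i @\<^sub>v vec_of_list [w $ i]"
  proof (rule eq_vecI)
    fix j assume "j < dim_vec (row M i @\<^sub>v vec_of_list [w $ i])"
    then have j: "j < Suc k" using M by auto
    then show "row (append_cols M [w]) i $ j = (row M i @\<^sub>v vec_of_list [w $ i]) $ j"
      using M w i by (auto simp: append_cols_def mat_of_cols_index nth_append less_Suc_eq)
  qed (use M in \<open>auto simp: append_cols_def\<close>)
  have "(append_cols M [w] *\<^sub>v (a @\<^sub>v vec_of_list [t])) $ i
      = (row M i @\<^sub>v vec_of_list [w $ i]) \<bullet> (a @\<^sub>v vec_of_list [t])"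
    using append_cols_carrier[OF M, of "[w]"] i by (simp add: row)
  also have "\<dots> = row M i \<bullet> a + vec_of_list [w $ i] \<bullet> vec_of_list [t]"
    by (rule scalar_prod_append[of _ k _ 1]) (use M a in \<open>auto intro!: carrier_vecI\<close>)
  also have "\<dots> = (M *\<^sub>v a + t \<cdot>\<^sub>v w) $ i"
    using M w i a by (simp add: scalar_prod_def)
  finally show "(append_cols M [w] *\<^sub>v (a @\<^sub>v vec_of_list [t])) $ i = (M *\<^sub>v a + t \<cdot>\<^sub>v w) $ i" .
qed (use M w in \<open>auto simp: append_cols_def\<close>)

lemma carrier_vec_SucE:
  assumes "x \<in> carrier_vec (Suc k)"
  obtains a t where "a \<in> carrier_vec k" "x = a @\<^sub>v vec_of_list [t]"
proof
  show "vec k (($) x) \<in> carrier_vec k" by simp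
  show "x = vec k (($) x) @\<^sub>v vec_of_list [x $ k]"
    using assms by (intro eq_vecI) (auto simp: less_Suc_eq)
qed

lemma mat_range_eq:
  fixes M :: "'a :: field mat"
  assumes "M \<in> carrier_mat N k"
  shows "mat_range M = {M *\<^sub>v x | x. x \<in> carrier_vec k}"
proof -
  interpret vec_space "TYPE('a)" N .
  show ?thesis using assms col_space_eq[OF assms] by auto
qed

text \<open>A new column outside the range could be added to a maximal independent set of columns, and
  would increase the rank.\<close>

lemma mem_range_if_rank_append_eq:
  fixes M :: "'a :: field mat"
  assumes M: "M \<in> carrier_mat N k" and w: "w \<in> carrier_vec N"
    and rank: "mat_rank (append_cols M [w]) = mat_rank M"
  shows "w \<in> mat_range M"
proof (rule ccontr)
  assume out: "w \<notin> mat_range M"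
  interpret V: vec_space "TYPE('a)" N .
  have cM: "set (cols M) \<subseteq> carrier_vec N" using M cols_dim[of M] by auto
  have Mw: "append_cols M [w] \<in> carrier_mat N (k + 1)" using append_cols_carrier[OF M, of "[w]"] by simp
  obtain S where S: "maximal S (\<lambda>T. T \<subseteq> set (cols M) \<and> V.lin_indpt T)" "finite S"
    using maximal_exists_superset[of "set (cols M)" "\<lambda>T. T \<subseteq> set (cols M) \<and> V.lin_indpt T" "{}"]
      V.finite_lin_indpt2[of "{}"] by auto
  then have Ssub: "S \<subseteq> set (cols M)" and Sind: "V.lin_indpt S" by (auto simp: maximal_def)
  have "w \<notin> V.span S"
    using out M V.span_is_monotone[OF Ssub] by (auto simp: V.col_space_def)
  moreover have "w \<notin> S" using calculation V.in_own_span[of S] Ssub cM by auto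
  ultimately have "V.lin_indpt (S \<union> {w})"
    using V.lin_dep_iff_in_span[of S w] Ssub Sind cM w by auto
  moreover have "S \<union> {w} \<subseteq> set (cols (append_cols M [w]))"
    using cols_append_cols[OF M, of "[w]"] w Ssub by auto
  ultimately have "card (S \<union> {w}) \<le> V.rank (append_cols M [w])"
    using V.rank_ge_card_indpt[OF Mw] by blast
  moreover have "card (S \<union> {w}) = Suc (card S)" using S \<open>w \<notin> S\<close> by simp
  moreover have "V.rank M = card S" by (rule V.rank_card_indpt[OF M S(1)])
  ultimately show False using rank M Mw by simp
qed

lemma rank_append_eqE:
  fixes M :: "'a :: field mat"
  assumes M: "M \<in> carrier_mat N k" and z: "z \<in> carrier_vec N" and w: "w \<in> carrier_vec N"
    and rank: "mat_rank (append_cols M [z, w]) = mat_rank (append_cols M [z])"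
  obtains a t where "a \<in> carrier_vec k" "w = M *\<^sub>v a + t \<cdot>\<^sub>v z"
proof -
  have Mz: "append_cols M [z] \<in> carrier_mat N (Suc k)" using append_cols_carrier[OF M, of "[z]"] by simp
  have "append_cols (append_cols M [z]) [w] = append_cols M [z, w]"
    using append_cols_append[OF M, of "[z]" "[w]"] z by simp
  then have "w \<in> mat_range (append_cols M [z])"
    using mem_range_if_rank_append_eq[OF Mz w] rank by simp
  then obtain x where x: "x \<in> carrier_vec (Suc k)" "w = append_cols M [z] *\<^sub>v x"
    unfolding mat_range_eq[OF Mz] by blast
  obtain a t where a: "a \<in> carrier_vec k" "x = a @\<^sub>v vec_of_list [t]"
    using carrier_vec_SucE[OF x(1)] .
  show thesis using that[OF a(1)] append_cols_mult[OF M z a(1)] x(2) a(2) by simp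
qed

section \<open>Polynomials in the shift operator\<close>

text \<open>This is \<open>p(S) w\<close> for the forward shift \<open>S\<close>. Sequences are indexed by all natural numbers, so
  that \<open>p \<mapsto> p(S)\<close> is a ring homomorphism without conditions on ranges.\<close>

definition shift_poly :: "'a :: comm_ring_1 poly \<Rightarrow> (nat \<Rightarrow> 'a) \<Rightarrow> nat \<Rightarrow> 'a" where
  "shift_poly p w k = (\<Sum>i\<le>degree p. coeff p i * w (k + i))"

text \<open>A summation range that does not depend on the polynomial lets polynomials of different degree be
  added and compared.\<close>

lemma shift_poly_altdef:
  "degree p \<le> d \<Longrightarrow> shift_poly p w k = (\<Sum>i<Suc d. coeff p i * w (k + i))"
  unfolding shift_poly_def lessThan_Suc_atMost
  by (rule sum.mono_neutral_left) (auto simp: coeff_eq_0)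

lemma shift_poly_0 [simp]: "shift_poly 0 w k = 0"
  by (simp add: shift_poly_def)

lemma shift_poly_pCons [simp]: "shift_poly (pCons a p) w k = a * w k + shift_poly p w (Suc k)"
proof -
  have "shift_poly (pCons a p) w k = (\<Sum>i<Suc (Suc (degree p)). coeff (pCons a p) i * w (k + i))"
    by (rule shift_poly_altdef) (simp add: degree_pCons_le)
  also have "\<dots> = a * w k + (\<Sum>i<Suc (degree p). coeff p i * w (Suc k + i))"
    by (subst sum.lessThan_Suc_shift) simp
  finally show ?thesis by (simp only: shift_poly_altdef[OF order_refl])
qed

lemma shift_poly_add: "shift_poly (p + q) w k = shift_poly p w k + shift_poly q w k"
proof -
  let ?d = "max (degree p) (degree q)"
  show ?thesis
    by (simp only: shift_poly_altdef[of _ ?d] degree_add_le_max max.cobounded1 max.cobounded2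
        coeff_add distrib_right sum.distrib)
qed

lemma shift_poly_smult: "shift_poly (Polynomial.smult a p) w k = a * shift_poly p w k"
  by (simp add: shift_poly_altdef[of _ "degree p"] degree_smult_le sum_distrib_left mult.assoc
      del: sum.lessThan_Suc)

lemma shift_poly_sum: "shift_poly (\<Sum>i\<in>I. p i) w k = (\<Sum>i\<in>I. shift_poly (p i) w k)"
  by (induction I rule: infinite_finite_induct) (auto simp: shift_poly_add)

lemma shift_poly_seq_sum:
  "shift_poly p (\<lambda>k. \<Sum>i\<in>I. w i k) k = (\<Sum>i\<in>I. shift_poly p (w i) k)"
  unfolding shift_poly_def sum_distrib_left by (rule sum.swap)

lemma shift_poly_seq_scale: "shift_poly p (\<lambda>k. a * w k) k = a * shift_poly p w k"
  by (simp add: shift_poly_def sum_distrib_left mult.left_commute)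

lemma shift_poly_mult: "shift_poly (p * q) w k = shift_poly p (shift_poly q w) k"
  by (induction p arbitrary: k) (simp_all add: shift_poly_add shift_poly_smult)

lemma poly_altdef_le:
  fixes p :: "'a :: comm_ring_1 poly"
  shows "degree p \<le> d \<Longrightarrow> poly p z = (\<Sum>i<Suc d. coeff p i * z ^ i)"
  unfolding poly_altdef lessThan_Suc_atMost
  by (rule sum.mono_neutral_left) (auto simp: coeff_eq_0)

lemma poly_pderiv_altdef:
  fixes p :: "'a :: {comm_ring_1, semiring_no_zero_divisors} poly"
  assumes "degree p \<le> d"
  shows "poly (pderiv p) z = (\<Sum>i<Suc d. coeff p i * (of_nat i * z ^ (i - 1)))"
proof -
  have "degree (pderiv p) \<le> d" using assms by (auto intro!: degree_le simp: coeff_pderiv coeff_eq_0)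
  then have "poly (pderiv p) z = (\<Sum>i<Suc d. coeff (pderiv p) i * z ^ i)" by (rule poly_altdef_le)
  also have "\<dots> = (\<Sum>i<Suc d. coeff p (Suc i) * (of_nat (Suc i) * z ^ i))"
    by (intro sum.cong) (auto simp: coeff_pderiv mult_ac)
  also have "\<dots> = (\<Sum>i<d. coeff p (Suc i) * (of_nat (Suc i) * z ^ i))"
    using assms by (simp add: coeff_eq_0)
  also have "\<dots> = (\<Sum>i<Suc d. coeff p i * (of_nat i * z ^ (i - 1)))"
    by (subst sum.lessThan_Suc_shift) simp
  finally show ?thesis .
qed

section \<open>The transfer function as a quotient of polynomials\<close>

text \<open>The matrix \<open>zE - A\<close> over the ring of polynomials in \<open>z\<close>. Its determinant and adjugate give
  the denominator and the numerator \<open>c\<^sup>T adj(zE - A) b\<close> of the transfer function, which need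
  not be coprime.\<close>

definition pencil_poly :: "real mat \<Rightarrow> real mat \<Rightarrow> complex poly mat" where
  "pencil_poly E A = mat (dim_row A) (dim_row A)
     (\<lambda>ij. [: - complex_of_real (A $$ ij), complex_of_real (E $$ ij) :])"

definition denom_poly :: "real mat \<Rightarrow> real mat \<Rightarrow> complex poly" where
  "denom_poly E A = det (pencil_poly E A)"

definition numer_poly :: "real mat \<Rightarrow> real mat \<Rightarrow> real vec \<Rightarrow> real vec \<Rightarrow> complex poly" where
  "numer_poly E A b c = (\<Sum>i<dim_row A. \<Sum>j<dim_row A.
     Polynomial.smult (complex_of_real (c $ i * b $ j)) (adj_mat (pencil_poly E A) $$ (i, j)))"

lemma pencil_poly_carrier: "A \<in> carrier_mat n n \<Longrightarrow> pencil_poly E A \<in> carrier_mat n n"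
  by (simp add: pencil_poly_def)

lemma degree_pencil_poly:
  assumes "A \<in> carrier_mat n n" "i < n" "j < n"
  shows "degree (pencil_poly E A $$ (i, j)) \<le> 1"
  using assms by (auto simp: pencil_poly_def)

lemma degree_denom_poly:
  assumes "A \<in> carrier_mat n n"
  shows "degree (denom_poly E A) \<le> n"
  using degree_det_le[of n "pencil_poly E A" 1] degree_pencil_poly[OF assms] pencil_poly_carrier[OF assms]
  by (simp add: denom_poly_def)

lemma degree_adj_mat_le:
  assumes M: "M \<in> carrier_mat n n" and deg: "\<And>i j. i < n \<Longrightarrow> j < n \<Longrightarrow> degree (M $$ (i, j)) \<le> k"
    and ij: "i < n" "j < n"
  shows "degree (adj_mat M $$ (i, j)) \<le> k * (n - 1)"
proof -
  have "degree (det (mat_delete M j i)) \<le> k * (n - 1)"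
  proof (rule degree_det_le)
    show "mat_delete M j i \<in> carrier_mat (n - 1) (n - 1)" using M by (rule mat_delete_carrier)
    show "degree (mat_delete M j i $$ (i', j')) \<le> k" if "i' < n - 1" "j' < n - 1" for i' j'
      using that M deg by (auto simp: mat_delete_def)
  qed
  moreover have "adj_mat M $$ (i, j) = (-1) ^ (j + i) * det (mat_delete M j i)"
    using M ij by (simp add: adj_mat_def cofactor_def)
  moreover have "degree ((-1) ^ m * p) = degree p" for m and p :: "'a poly"
    by (cases "even m") auto
  ultimately show ?thesis by simp
qed

lemma degree_numer_poly:
  assumes A: "A \<in> carrier_mat n n"
  shows "degree (numer_poly E A b c) \<le> n"
proof -
  have "degree (adj_mat (pencil_poly E A) $$ (i, j)) \<le> n" if "i < n" "j < n" for i j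
    using degree_adj_mat_le[OF pencil_poly_carrier[OF A, of E] degree_pencil_poly[OF A] that] by simp
  then show ?thesis
    unfolding numer_poly_def using A by (auto intro!: degree_sum_le order_trans[OF degree_smult_le])
qed

lemma eval_pencil_poly:
  assumes "E \<in> carrier_mat n n" "A \<in> carrier_mat n n"
  shows "map_mat (\<lambda>p. poly p z) (pencil_poly E A) = pencil E A z"
  using assms by (intro eq_matI) (auto simp: pencil_poly_def pencil_def)

lemma det_pencil:
  assumes "E \<in> carrier_mat n n" "A \<in> carrier_mat n n"
  shows "det (pencil E A z) = poly (denom_poly E A) z"
proof -
  interpret ev: comm_ring_hom "\<lambda>p. poly p z" by unfold_locales auto
  show ?thesis
    unfolding denom_poly_def eval_pencil_poly[OF assms, symmetric] by (rule ev.hom_det)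
qed

lemma pencil_carrier:
  assumes "E \<in> carrier_mat n n" "A \<in> carrier_mat n n"
  shows "pencil E A z \<in> carrier_mat n n"
  using assms unfolding pencil_def by (intro minus_carrier_mat) auto

lemma denom_poly_nonzero:
  assumes E: "E \<in> carrier_mat n n" and A: "A \<in> carrier_mat n n"
    and "\<not> pencil_eigenvalue E A z"
  shows "poly (denom_poly E A) z \<noteq> 0"
  using assms(3) A unfolding det_pencil[OF E A, symmetric] pencil_eigenvalue_def
  by (simp add: det_0_iff_vec_prod_zero[OF pencil_carrier[OF E A]])

text \<open>Evaluation at \<open>z\<close> is a ring homomorphism, so it maps the polynomial adjugate to
  \<open>d(z) (zE - A)\<^sup>-\<^sup>1\<close>.\<close>

lemma transfer_function_mult_denom:
  assumes E: "E \<in> carrier_mat n n" and A: "A \<in> carrier_mat n n"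
    and b: "b \<in> carrier_vec n" and c: "c \<in> carrier_vec n"
    and nz: "poly (denom_poly E A) z \<noteq> 0"
  shows "transfer_function E A b c z * poly (denom_poly E A) z = poly (numer_poly E A b c) z"
proof -
  interpret ev: comm_ring_hom "\<lambda>p. poly p z" by unfold_locales auto
  let ?P = "pencil E A z" and ?ev = "map_mat (\<lambda>p. poly p z)"
  let ?M = "pencil_poly E A" and ?d = "poly (denom_poly E A) z"
  have P: "?P \<in> carrier_mat n n" by (rule pencil_carrier[OF E A])
  have M: "?M \<in> carrier_mat n n" by (rule pencil_poly_carrier[OF A])
  have "?P \<in> Units (ring_mat TYPE(complex) n ())"
    by (rule det_non_zero_imp_unit[OF P]) (use nz det_pencil[OF E A] in simp)
  then obtain B where B: "mat_inverse ?P = Some B"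
    using mat_inverse(1)[OF P, where b = "()"] by (cases "mat_inverse ?P") auto
  have PB: "?P * B = 1\<^sub>m n" and Bc: "B \<in> carrier_mat n n"
    using mat_inverse(2)[OF P B] by auto
  have adjc: "adj_mat ?M \<in> carrier_mat n n" by (rule adj_mat(1)[OF M])
  have "?ev (adj_mat ?M) * ?P = ?ev (adj_mat ?M * ?M)"
    by (simp add: ev.mat_hom_mult[OF adjc M] eval_pencil_poly[OF E A])
  also have "\<dots> = ?d \<cdot>\<^sub>m 1\<^sub>m n"
    unfolding adj_mat(3)[OF M] denom_poly_def by (rule eq_matI) auto
  finally have "?ev (adj_mat ?M) * ?P * B = ?d \<cdot>\<^sub>m 1\<^sub>m n * B" by simp
  then have adj: "?ev (adj_mat ?M) = ?d \<cdot>\<^sub>m B"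
    using adjc P Bc PB
    by (subst (asm) assoc_mult_mat[of _ n n _ n _ n]) (auto simp: mult_smult_assoc_mat[of _ n n])
  have entry: "poly (adj_mat ?M $$ (i, j)) z = ?d * B $$ (i, j)" if "i < n" "j < n" for i j
    using arg_cong[OF adj, of "\<lambda>X. X $$ (i, j)"] that adjc Bc by simp
  have "poly (numer_poly E A b c) z
      = (\<Sum>i<n. \<Sum>j<n. complex_of_real (c $ i * b $ j) * (?d * B $$ (i, j)))"
    using A by (simp add: numer_poly_def poly_sum entry)
  also have "\<dots> = transfer_function E A b c z * ?d"
    using b c Bc
    by (simp add: transfer_function_def B scalar_prod_def sum_distrib_left sum_distrib_right
        lessThan_atLeast0 mult_ac)
  finally show ?thesis by simp
qed

text \<open>The set where \<open>d\<close> does not vanish is open, so \<open>H = N/d\<close> holds near \<open>\<sigma>\<close> and the quotient rule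
  applies.\<close>

lemma deriv_transfer_function:
  assumes E: "E \<in> carrier_mat n n" and A: "A \<in> carrier_mat n n"
    and b: "b \<in> carrier_vec n" and c: "c \<in> carrier_vec n"
    and nz: "poly (denom_poly E A) \<sigma> \<noteq> 0"
  defines "H \<equiv> transfer_function E A b c"
  shows "deriv H \<sigma> * poly (denom_poly E A) \<sigma>
      = poly (pderiv (numer_poly E A b c)) \<sigma> - H \<sigma> * poly (pderiv (denom_poly E A)) \<sigma>"
proof -
  let ?d = "poly (denom_poly E A)" and ?d' = "poly (pderiv (denom_poly E A))"
  let ?N = "poly (numer_poly E A b c)" and ?N' = "poly (pderiv (numer_poly E A b c))"
  let ?S = "{z. ?d z \<noteq> 0}"
  have H: "?N z / ?d z = H z" if "z \<in> ?S" for z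
    using transfer_function_mult_denom[OF E A b c, of z] that by (simp add: H_def field_simps)
  have "open ?S" by (intro open_Collect_neq continuous_intros)
  moreover have "((\<lambda>z. ?N z / ?d z) has_field_derivative
      (?N' \<sigma> * ?d \<sigma> - ?N \<sigma> * ?d' \<sigma>) / (?d \<sigma> * ?d \<sigma>)) (at \<sigma>)"
    by (rule DERIV_divide[OF poly_DERIV poly_DERIV nz])
  ultimately have "(H has_field_derivative
      (?N' \<sigma> * ?d \<sigma> - ?N \<sigma> * ?d' \<sigma>) / (?d \<sigma> * ?d \<sigma>)) (at \<sigma>)"
    using has_field_derivative_transform_within_open[of _ _ \<sigma> ?S H] H nz by auto
  then have "deriv H \<sigma> = (?N' \<sigma> * ?d \<sigma> - ?N \<sigma> * ?d' \<sigma>) / (?d \<sigma> * ?d \<sigma>)"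
    by (rule DERIV_imp_deriv)
  also have "?N \<sigma> = H \<sigma> * ?d \<sigma>"
    using transfer_function_mult_denom[OF E A b c nz] by (simp add: H_def)
  also have "?N' \<sigma> * ?d \<sigma> - H \<sigma> * ?d \<sigma> * ?d' \<sigma> = (?N' \<sigma> - H \<sigma> * ?d' \<sigma>) * ?d \<sigma>"
    by (simp add: algebra_simps)
  finally show ?thesis using nz by simp
qed

section \<open>The difference equation satisfied by the data\<close>

text \<open>The state is known up to time \<open>T\<close> only. Because \<open>E\<close> is nonsingular it can be continued
  forever, driven after time \<open>T\<close> by the arbitrary values that \<open>us $ k\<close> takes outside the bounds
  of \<open>us\<close>. The shift calculus then applies without boundary terms.\<close>

lemma trajectory_extension:
  assumes sys: "siso_system n E A b c" and traj: "io_trajectory n E A b c T us ys"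
  obtains x :: "nat \<Rightarrow> real vec" where
    "\<And>k. x k \<in> carrier_vec n"
    "\<And>k. E *\<^sub>v x (Suc k) = A *\<^sub>v x k + (us $ k) \<cdot>\<^sub>v b"
    "\<And>k. k \<le> T \<Longrightarrow> ys $ k = c \<bullet> x k"
proof -
  from sys have E: "E \<in> carrier_mat n n" and A: "A \<in> carrier_mat n n"
    and b: "b \<in> carrier_vec n" and inv: "invertible_mat E"
    by (auto simp: siso_system_def)
  obtain F where F: "E * F = 1\<^sub>m n" "F * E = 1\<^sub>m (dim_row F)"
    using inv E by (auto simp: invertible_mat_def inverts_mat_def)
  have Fc: "F \<in> carrier_mat n n"
    using arg_cong[OF F(1), of dim_col] arg_cong[OF F(2), of dim_col] E by auto
  from traj obtain x0 where x0: "\<And>k. k \<le> T \<Longrightarrow> x0 k \<in> carrier_vec n"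
    "\<And>k. k < T \<Longrightarrow> E *\<^sub>v x0 (Suc k) = A *\<^sub>v x0 k + (us $ k) \<cdot>\<^sub>v b"
    "\<And>k. k \<le> T \<Longrightarrow> ys $ k = c \<bullet> x0 k"
    unfolding io_trajectory_def by auto
  define x where "x = rec_nat (x0 0) (\<lambda>k s. F *\<^sub>v (A *\<^sub>v s + (us $ k) \<cdot>\<^sub>v b))"
  have x_Suc: "x (Suc k) = F *\<^sub>v (A *\<^sub>v x k + (us $ k) \<cdot>\<^sub>v b)" for k by (simp add: x_def)
  have xc: "x k \<in> carrier_vec n" for k
    using x0(1)[of 0] Fc by (cases k) (auto simp: x_def intro!: carrier_vecI)
  have agree: "x k = x0 k" if "k \<le> T" for k
    using that
  proof (induction k)
    case (Suc k)
    then have "x (Suc k) = F *\<^sub>v (E *\<^sub>v x0 (Suc k))" using x0(2)[of k] by (simp add: x_Suc)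
    also have "\<dots> = x0 (Suc k)"
      using x0(1)[OF Suc.prems] Fc E F(2) by (simp add: assoc_mult_mat_vec[of F n n E n, symmetric])
    finally show ?case .
  qed (simp add: x_def)
  show thesis
  proof (rule that)
    show "E *\<^sub>v x (Suc k) = A *\<^sub>v x k + (us $ k) \<cdot>\<^sub>v b" for k
      unfolding x_Suc using E Fc F(1) A b xc[of k]
      by (simp add: assoc_mult_mat_vec[of E n n F n, symmetric])
  qed (use xc agree x0(3) in auto)
qed

text \<open>The state equation reads \<open>M(S) x = b u\<close> with \<open>M = zE - A\<close>. Multiplying by \<open>adj(M)(S)\<close> gives
  \<open>d(S) x = adj(M)(S) b u\<close>, and taking the product with \<open>c\<close> gives \<open>d(S) y = N(S) u\<close>. The bound
  \<open>k + n \<le> T\<close> enters only at the end: with both degrees at most \<open>n\<close>, the equation at time \<open>k\<close>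
  involves recorded samples only.\<close>

lemma difference_equation:
  assumes sys: "siso_system n E A b c" and traj: "io_trajectory n E A b c T us ys"
    and k: "k + n \<le> T"
  shows "(\<Sum>i<Suc n. coeff (denom_poly E A) i * complex_of_real (ys $ (k + i)))
       = (\<Sum>i<Suc n. coeff (numer_poly E A b c) i * complex_of_real (us $ (k + i)))"
proof -
  from sys have E: "E \<in> carrier_mat n n" and A: "A \<in> carrier_mat n n"
    and b: "b \<in> carrier_vec n" and c: "c \<in> carrier_vec n"
    by (auto simp: siso_system_def)
  obtain x where xc: "\<And>k. x k \<in> carrier_vec n"
    and step: "\<And>k. E *\<^sub>v x (Suc k) = A *\<^sub>v x k + (us $ k) \<cdot>\<^sub>v b"
    and out: "\<And>k. k \<le> T \<Longrightarrow> ys $ k = c \<bullet> x k"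
    by (rule trajectory_extension[OF sys traj]) blast
  let ?M = "pencil_poly E A" and ?d = "denom_poly E A"
  have M: "?M \<in> carrier_mat n n" by (rule pencil_poly_carrier[OF A])
  define X where "X j k = complex_of_real (x k $ j)" for j k
  define W where "W k = complex_of_real (us $ k)" for k
  define Y where "Y k = complex_of_real (c \<bullet> x k)" for k
  have state: "(\<Sum>j<n. shift_poly (?M $$ (i, j)) (X j) k) = complex_of_real (b $ i) * W k"
    if i: "i < n" for i k
  proof -
    have "(\<Sum>j<n. shift_poly (?M $$ (i, j)) (X j) k)
        = complex_of_real ((\<Sum>j<n. E $$ (i, j) * x (Suc k) $ j) - (\<Sum>j<n. A $$ (i, j) * x k $ j))"
      using i A by (simp add: pencil_poly_def X_def sum_subtractf[symmetric] algebra_simps)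
    also have "(\<Sum>j<n. E $$ (i, j) * x (Suc k) $ j) = (E *\<^sub>v x (Suc k)) $ i"
      using i E xc[of "Suc k"] by (simp add: scalar_prod_def lessThan_atLeast0)
    also have "(\<Sum>j<n. A $$ (i, j) * x k $ j) = (A *\<^sub>v x k) $ i"
      using i A xc[of k] by (simp add: scalar_prod_def lessThan_atLeast0)
    finally show ?thesis using i A b by (simp add: step W_def)
  qed
  have adj: "(\<Sum>i<n. adj_mat ?M $$ (l, i) * ?M $$ (i, j)) = (if l = j then ?d else 0)"
    if lj: "l < n" "j < n" for l j
    using arg_cong[OF adj_mat(3)[OF M], of "\<lambda>B. B $$ (l, j)"] lj M adj_mat(1)[OF M]
    by (simp add: scalar_prod_def lessThan_atLeast0 denom_poly_def)
  \<comment> \<open>Each component separately satisfies a scalar equation, since the adjugate diagonalises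
    the system.\<close>
  have comp: "shift_poly ?d (X l) k = (\<Sum>i<n. complex_of_real (b $ i) * shift_poly (adj_mat ?M $$ (l, i)) W k)"
    if l: "l < n" for l k
  proof -
    have "shift_poly ?d (X l) k = (\<Sum>j<n. shift_poly (if l = j then ?d else 0) (X j) k)"
      using l by (simp add: if_distrib[of "\<lambda>p. shift_poly p _ _"] sum.delta cong: if_cong)
    also have "\<dots> = (\<Sum>j<n. \<Sum>i<n. shift_poly (adj_mat ?M $$ (l, i)) (shift_poly (?M $$ (i, j)) (X j)) k)"
      using l by (intro sum.cong refl) (simp add: adj[symmetric] shift_poly_sum shift_poly_mult)
    also have "\<dots> = (\<Sum>i<n. shift_poly (adj_mat ?M $$ (l, i)) (\<lambda>k. \<Sum>j<n. shift_poly (?M $$ (i, j)) (X j) k) k)"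
      unfolding shift_poly_seq_sum by (rule sum.swap)
    also have "\<dots> = (\<Sum>i<n. complex_of_real (b $ i) * shift_poly (adj_mat ?M $$ (l, i)) W k)"
      by (simp add: state shift_poly_seq_scale)
    finally show ?thesis .
  qed
  have Y: "Y = (\<lambda>k. \<Sum>l<n. complex_of_real (c $ l) * X l k)"
    by (rule ext) (simp add: Y_def X_def scalar_prod_def lessThan_atLeast0 carrier_vecD[OF xc])
  have "shift_poly ?d Y k = (\<Sum>l<n. complex_of_real (c $ l) * shift_poly ?d (X l) k)"
    unfolding Y shift_poly_seq_sum shift_poly_seq_scale ..
  also have "\<dots> = shift_poly (numer_poly E A b c) W k"
    using A by (simp add: comp numer_poly_def shift_poly_sum shift_poly_smult sum_distrib_left mult.assoc)
  finally have "(\<Sum>i<Suc n. coeff ?d i * Y (k + i)) = (\<Sum>i<Suc n. coeff (numer_poly E A b c) i * W (k + i))"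
    by (simp only: shift_poly_altdef[OF degree_denom_poly[OF A]] shift_poly_altdef[OF degree_numer_poly[OF A]])
  moreover have "Y (k + i) = complex_of_real (ys $ (k + i))" if "i < Suc n" for i
    using that k out[of "k + i"] by (simp add: Y_def)
  ultimately show ?thesis by (simp add: W_def del: sum.lessThan_Suc)
qed

section \<open>The left annihilator of the data\<close>

text \<open>The coefficients of the difference equation, arranged to match a column of the data matrix:
  input samples above, output samples below.\<close>

definition annihilator :: "nat \<Rightarrow> complex poly \<Rightarrow> complex poly \<Rightarrow> complex vec" where
  "annihilator n N d = vec (n + 1) (coeff N) @\<^sub>v (- vec (n + 1) (coeff d))"

lemma annihilator_carrier: "annihilator n N d \<in> carrier_vec (2 * (n + 1))"
  by (rule carrier_vecI) (simp add: annihilator_def)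

lemma annihilator_prod_append:
  assumes "x \<in> carrier_vec (n + 1)" "y \<in> carrier_vec (n + 1)"
  shows "annihilator n N d \<bullet> (x @\<^sub>v y)
      = (\<Sum>i<Suc n. coeff N i * x $ i) - (\<Sum>i<Suc n. coeff d i * y $ i)"
proof -
  have "annihilator n N d \<bullet> (x @\<^sub>v y)
      = vec (n + 1) (coeff N) \<bullet> x + (- vec (n + 1) (coeff d)) \<bullet> y"
    unfolding annihilator_def by (rule scalar_prod_append) (use assms in auto)
  then show ?thesis
    using assms
    by (simp add: scalar_prod_def sum_negf lessThan_atLeast0 del: sum.lessThan_Suc sum.op_ivl_Suc)
qed

text \<open>Real columns and complex combinations: orthogonality to the former passes to the latter.\<close>

lemma orthogonal_cmat_range:
  assumes D: "D \<in> carrier_mat N m" and r: "r \<in> carrier_vec N"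
    and cols: "\<And>j. j < m \<Longrightarrow> r \<bullet> cvec (col D j) = 0"
    and w: "w \<in> mat_range (cmat D)"
  shows "r \<bullet> w = 0"
proof -
  have Dc: "cmat D \<in> carrier_mat N m" using D by simp
  obtain a where a: "a \<in> carrier_vec m" "w = cmat D *\<^sub>v a"
    using w unfolding mat_range_eq[OF Dc] by blast
  have "(cmat D)\<^sup>T *\<^sub>v r = 0\<^sub>v m"
  proof (rule eq_vecI)
    fix j assume "j < dim_vec (0\<^sub>v m :: complex vec)"
    then have j: "j < m" by simp
    have "((cmat D)\<^sup>T *\<^sub>v r) $ j = cvec (col D j) \<bullet> r"
      using D j by simp
    also have "\<dots> = r \<bullet> cvec (col D j)" by (rule comm_scalar_prod) (use D r in auto)
    finally show "((cmat D)\<^sup>T *\<^sub>v r) $ j = 0\<^sub>v m $ j" using cols[OF j] j by simp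
  qed (use D in auto)
  then show ?thesis
    using transpose_vec_mult_scalar[OF Dc a(1) r] a by simp
qed

lemma col_mem_mat_range:
  fixes M :: "'a :: field mat"
  assumes M: "M \<in> carrier_mat N k" and "j < k"
  shows "col M j \<in> mat_range M"
proof -
  interpret V: vec_space "TYPE('a)" N .
  have "col M j \<in> set (cols M)" using assms by (auto simp: cols_def)
  moreover have "set (cols M) \<subseteq> carrier_vec N" using M cols_dim[of M] by auto
  ultimately show ?thesis using V.in_own_span[of "set (cols M)"] M by (auto simp: V.col_space_def)
qed

lemma cvec_mem_mat_range:
  assumes D: "D \<in> carrier_mat N m" and y: "y \<in> mat_range D"
  shows "cvec y \<in> mat_range (cmat D)"
proof -
  have Dc: "cmat D \<in> carrier_mat N m" using D by simp
  obtain a where a: "a \<in> carrier_vec m" "y = D *\<^sub>v a"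
    using y unfolding mat_range_eq[OF D] by blast
  have "cvec y = cmat D *\<^sub>v cvec a"
    unfolding a(2) by (rule of_real_hom.mult_mat_vec_hom[OF D a(1)])
  then show ?thesis unfolding mat_range_eq[OF Dc] using a(1) by auto
qed

lemma data_matrix_carrier: "data_matrix n T us ys \<in> carrier_mat (2 * (n + 1)) (T - n + 1)"
  unfolding data_matrix_def hankel_def by (rule carrier_matI) (auto simp: append_rows_def)

lemma col_data_matrix:
  assumes "j < T - n + 1"
  shows "col (data_matrix n T us ys) j
      = vec (n + 1) (\<lambda>i. us $ (i + j)) @\<^sub>v vec (n + 1) (\<lambda>i. ys $ (i + j))"
  using assms data_matrix_carrier[of n T us ys]
  by (intro eq_vecI) (auto simp: data_matrix_def hankel_def append_rows_def)

lemma annihilator_data_matrix: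
  assumes sys: "siso_system n E A b c" and traj: "io_trajectory n E A b c T us ys" and T: "n \<le> T"
    and j: "j < T - n + 1"
  shows "annihilator n (numer_poly E A b c) (denom_poly E A) \<bullet> cvec (col (data_matrix n T us ys) j) = 0"
proof -
  have "cvec (col (data_matrix n T us ys) j)
      = vec (n + 1) (\<lambda>i. complex_of_real (us $ (i + j))) @\<^sub>v vec (n + 1) (\<lambda>i. complex_of_real (ys $ (i + j)))"
    unfolding col_data_matrix[OF j] by (intro eq_vecI) auto
  then show ?thesis
    using difference_equation[OF sys traj, of j] T j
    by (simp add: annihilator_prod_append add.commute del: sum.lessThan_Suc)
qed

lemma annihilator_zvec:
  assumes "degree d \<le> n"
  shows "annihilator n N d \<bullet> zvec n \<sigma> = poly d \<sigma>"
  unfolding zvec_def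
  by (subst annihilator_prod_append)
    (simp_all add: gam_def poly_altdef_le[OF assms] sum_negf del: sum.lessThan_Suc)

text \<open>Pairing coefficients with the derivatives of powers evaluates the derivative polynomials. The
  right-hand side is \<open>H' d\<close> when \<open>H = N/d\<close>, by the quotient rule.\<close>

lemma annihilator_bvec1:
  assumes "degree N \<le> n" "degree d \<le> n"
  shows "annihilator n N d \<bullet> bvec1 n H \<sigma> = poly (pderiv N) \<sigma> - H \<sigma> * poly (pderiv d) \<sigma>"
  unfolding bvec1_def
  by (subst annihilator_prod_append)
    (simp_all add: gam1_def poly_pderiv_altdef[OF assms(1)] poly_pderiv_altdef[OF assms(2)]
      sum_distrib_left mult.left_commute del: sum.lessThan_Suc)

lemma vnorm_zvec: "vnorm (zvec n \<sigma>) = vnorm (gam n \<sigma>)"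
proof -
  have "vnorm (0\<^sub>v m) = 0" for m by (simp add: vnorm_def L2_set_def)
  then have "(vnorm (zvec n \<sigma>))\<^sup>2 = (vnorm (gam n \<sigma>))\<^sup>2"
    by (simp add: zvec_def vnorm_append vnorm_uminus)
  then show ?thesis by (simp add: vnorm_nonneg)
qed

lemma vnorm_bvec1:
  "(vnorm (bvec1 n H \<sigma>))\<^sup>2 = (1 + (cmod (H \<sigma>))\<^sup>2) * (vnorm (gam1 n \<sigma>))\<^sup>2"
  by (simp add: bvec1_def vnorm_append vnorm_smult power_mult_distrib distrib_right)

section \<open>Recovering the derivative of the transfer function\<close>

theorem mainTheorem4:
  fixes n T p :: nat
    and E A :: "real mat" and b c :: "real vec"
    and us ys :: "real vec"
    and U :: "real mat"
    and \<sigma> :: complex and H :: "complex \<Rightarrow> complex"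
    and u v :: "complex vec" and \<theta> \<alpha> :: real
  assumes system: "siso_system n E A b c"
    and stable: "asymptotically_stable E A"
    and H_def: "H = transfer_function E A b c"
    and T: "n \<le> T"
    and data: "io_trajectory n E A b c T us ys"
    and not_pole: "\<not> pencil_eigenvalue E A \<sigma>"
    and U_carrier: "U \<in> carrier_mat (2 * (n + 1)) p"
    and U_orthonormal: "transpose_mat U * U = 1\<^sub>m p"
    and U_range: "mat_range U = mat_range (data_matrix n T us ys)"
    and rank_b: "mat_rank (append_cols (cmat U) [zvec n \<sigma>, bvec n \<sigma>])
                   = mat_rank (append_cols (cmat U) [zvec n \<sigma>])"
    and rank_z: "mat_rank (append_cols (cmat U) [zvec n \<sigma>]) = mat_rank (cmat U) + 1"
    and rank_b1: "mat_rank (append_cols (cmat U) [zvec n \<sigma>, bvec1 n H \<sigma>])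
                   = mat_rank (append_cols (cmat U) [zvec n \<sigma>])"
    and v_carrier: "v \<in> carrier_vec (2 * (n + 1))"
    and decomp: "zvec n \<sigma> = u + v"
    and u_range: "u \<in> mat_range (cmat U)"
    and v_orth: "transpose_mat (cmat U) *\<^sub>v v = 0\<^sub>v p"
    and \<theta>_def: "\<theta> = angle_to_subspace (zvec n \<sigma>) (mat_range (cmat U))"
    and \<alpha>_def: "\<alpha> = sin \<theta>"
  shows "0 < \<theta> \<and> \<theta> \<le> pi / 2 \<and>
         \<alpha> = vnorm v / vnorm (zvec n \<sigma>) \<and>
         \<alpha> = vnorm v / vnorm (gam n \<sigma>) \<and>
         (\<exists>!\<xi>. \<xi> \<in> carrier_vec p \<and>
            append_cols (cmat U) [v] *\<^sub>v (\<xi> @\<^sub>v vec_of_list [deriv H \<sigma>])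
              = gam1 n \<sigma> @\<^sub>v (H \<sigma> \<cdot>\<^sub>v gam1 n \<sigma>)) \<and>
         (\<forall>\<xi> \<in> carrier_vec p.
            append_cols (cmat U) [v] *\<^sub>v (\<xi> @\<^sub>v vec_of_list [deriv H \<sigma>])
              = gam1 n \<sigma> @\<^sub>v (H \<sigma> \<cdot>\<^sub>v gam1 n \<sigma>) \<longrightarrow>
            (vnorm \<xi>)\<^sup>2 + (cmod (deriv H \<sigma>))\<^sup>2 * \<alpha>\<^sup>2 * (vnorm (gam n \<sigma>))\<^sup>2
              = (1 + (cmod (H \<sigma>))\<^sup>2) * (vnorm (gam1 n \<sigma>))\<^sup>2 \<and>
            (deriv H \<sigma> \<noteq> 0 \<longrightarrow>
               \<alpha> = sqrt (((1 + (cmod (H \<sigma>))\<^sup>2) * (vnorm (gam1 n \<sigma>))\<^sup>2 - (vnorm \<xi>)\<^sup>2)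
                         / ((cmod (deriv H \<sigma>))\<^sup>2 * (vnorm (gam n \<sigma>))\<^sup>2))))"
proof -
  let ?N = "2 * (n + 1)" and ?U = "cmat U" and ?z = "zvec n \<sigma>"
  let ?D = "data_matrix n T us ys" and ?d = "denom_poly E A"
  let ?r = "annihilator n (numer_poly E A b c) ?d"
  let ?H' = "deriv H \<sigma>"
  from system have E: "E \<in> carrier_mat n n" and A: "A \<in> carrier_mat n n"
    and b: "b \<in> carrier_vec n" and c: "c \<in> carrier_vec n"
    by (auto simp: siso_system_def)
  have Uc: "?U \<in> carrier_mat ?N p" using U_carrier by simp
  have z: "?z \<in> carrier_vec ?N" by (rule carrier_vecI) (simp add: zvec_def gam_def)
  have bv: "bvec n \<sigma> \<in> carrier_vec ?N" by (rule carrier_vecI) (simp add: bvec_def gam_def)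
  have b1: "bvec1 n H \<sigma> \<in> carrier_vec ?N" by (rule carrier_vecI) (simp add: bvec1_def gam1_def)
  have r: "?r \<in> carrier_vec ?N" by (rule annihilator_carrier)
  have nz: "poly ?d \<sigma> \<noteq> 0" by (rule denom_poly_nonzero[OF E A not_pole])

  have r_data: "?r \<bullet> w = 0" if "w \<in> mat_range (cmat ?D)" for w
    using orthogonal_cmat_range[OF data_matrix_carrier r annihilator_data_matrix[OF system data T] that] .
  have r_U: "?r \<bullet> w = 0" if "w \<in> mat_range ?U" for w
  proof (rule orthogonal_cmat_range[OF U_carrier r _ that])
    fix j assume "j < p"
    then have "col U j \<in> mat_range ?D" using col_mem_mat_range[OF U_carrier] U_range by simp
    then show "?r \<bullet> cvec (col U j) = 0" by (intro r_data cvec_mem_mat_range[OF data_matrix_carrier])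
  qed
  have r_z: "?r \<bullet> ?z = poly ?d \<sigma>" by (rule annihilator_zvec[OF degree_denom_poly[OF A]])
  have range: "mat_range ?U = {?U *\<^sub>v x | x. x \<in> carrier_vec p}" by (rule mat_range_eq[OF Uc])
  obtain g where g: "g \<in> carrier_vec p" "u = ?U *\<^sub>v g" using u_range unfolding range by blast
  have u: "u \<in> carrier_vec ?N" using g Uc by simp

  have v_nz: "v \<noteq> 0\<^sub>v ?N"
  proof
    assume "v = 0\<^sub>v ?N"
    then have "?z = u" using decomp u by simp
    then show False using r_U[OF u_range] r_z nz by simp
  qed
  have z_nz: "?z \<noteq> 0\<^sub>v ?N" using r_z nz r by auto
  have vpos: "0 < vnorm v" using vnorm_pos[of v] v_nz v_carrier by simp
  have zpos: "0 < vnorm ?z" using vnorm_pos[of ?z] z_nz z by simp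

  have orth: "v \<bullet> conjugate (?U *\<^sub>v x) = 0" if "x \<in> carrier_vec p" for x
    using scalar_prod_cmat_mult_conjugate[OF U_carrier that v_carrier] v_orth that by simp

  \<comment> \<open>If \<open>U\<close> had no columns, \<open>b(\<sigma>)\<close> would be a multiple of \<open>z(\<sigma>)\<close>, but their first entries
    are 1 and 0.\<close>
  have "p \<noteq> 0"
  proof
    assume p: "p = 0"
    obtain a t where a: "a \<in> carrier_vec p" and eq: "bvec n \<sigma> = ?U *\<^sub>v a + t \<cdot>\<^sub>v ?z"
      using rank_append_eqE[OF Uc z bv rank_b] .
    have "bvec n \<sigma> $ 0 = 0"
      unfolding eq using p Uc a z by (simp add: scalar_prod_def zvec_def gam_def)
    then show False by (simp add: bvec_def gam_def)
  qed
  then have unit: "unit_vec p 0 \<in> carrier_vec p" "unit_vec p 0 \<noteq> (0\<^sub>v p :: complex vec)" by auto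
  define w0 where "w0 = ?U *\<^sub>v unit_vec p 0"
  have w0: "w0 \<in> mat_range ?U" "w0 \<noteq> 0\<^sub>v ?N"
  proof -
    show "w0 \<in> mat_range ?U" unfolding range w0_def using unit by blast
    have "0 < vnorm w0"
      unfolding w0_def vnorm_cmat_mult[OF U_carrier U_orthonormal unit(1)] using vnorm_pos unit by simp
    then show "w0 \<noteq> 0\<^sub>v ?N" by (auto simp: vnorm_def L2_set_def)
  qed

  have range_sub: "mat_range ?U \<subseteq> carrier_vec ?N" unfolding range using Uc by auto
  have range_orth: "v \<bullet> conjugate w = 0" if "w \<in> mat_range ?U" for w
    using that orth unfolding range by blast
  note angle = angle_to_subspace_orthogonal_decomp[OF range_sub u_range v_carrier _
      z_nz[unfolded decomp] w0, folded decomp, folded \<theta>_def]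
  have \<theta>_eq: "\<theta> = arccos (vnorm u / vnorm ?z)" by (rule angle(1)[OF range_orth])
  have \<alpha>: "\<alpha> = vnorm v / vnorm ?z" unfolding \<alpha>_def by (rule angle(2)[OF range_orth])
  have pyth: "(vnorm ?z)\<^sup>2 = (vnorm u)\<^sup>2 + (vnorm v)\<^sup>2"
    unfolding decomp by (rule vnorm_add_orthogonal[OF u v_carrier range_orth[OF u_range]])
  have "(vnorm u)\<^sup>2 \<le> (vnorm ?z)\<^sup>2" using pyth by simp
  then have q: "0 \<le> vnorm u / vnorm ?z" "vnorm u / vnorm ?z \<le> 1"
    using zpos by (auto simp: power2_le_iff_abs_le vnorm_nonneg)
  have "0 \<le> \<theta>" using arccos_lbound[of "vnorm u / vnorm ?z"] q by (simp add: \<theta>_eq)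
  moreover have "\<theta> \<noteq> 0" using \<alpha> vpos zpos by (auto simp: \<alpha>_def)
  ultimately have \<theta>_pos: "0 < \<theta>" by simp
  have \<theta>_le: "\<theta> \<le> pi / 2" unfolding \<theta>_eq using q by (rule arccos_le_pi2)

  obtain a t where a: "a \<in> carrier_vec p" and eq: "bvec1 n H \<sigma> = ?U *\<^sub>v a + t \<cdot>\<^sub>v ?z"
    using rank_append_eqE[OF Uc z b1 rank_b1] .
  have "?U *\<^sub>v a \<in> mat_range ?U" unfolding range using a by blast
  then have "?r \<bullet> bvec1 n H \<sigma> = t * poly ?d \<sigma>"
    unfolding eq using r z Uc a r_U
    by (simp add: scalar_prod_add_distrib[of _ ?N] r_z)
  moreover have "?r \<bullet> bvec1 n H \<sigma> = ?H' * poly ?d \<sigma>"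
    unfolding annihilator_bvec1[OF degree_numer_poly[OF A] degree_denom_poly[OF A]]
    using deriv_transfer_function[OF E A b c nz] by (simp add: H_def)
  ultimately have t: "t = ?H'" using nz by simp

  have mult: "append_cols ?U [v] *\<^sub>v (\<xi> @\<^sub>v vec_of_list [?H']) = ?U *\<^sub>v \<xi> + ?H' \<cdot>\<^sub>v v"
    if "\<xi> \<in> carrier_vec p" for \<xi>
    by (rule append_cols_mult[OF Uc v_carrier that])
  let ?eqn = "\<lambda>\<xi>. append_cols ?U [v] *\<^sub>v (\<xi> @\<^sub>v vec_of_list [?H'])
      = gam1 n \<sigma> @\<^sub>v (H \<sigma> \<cdot>\<^sub>v gam1 n \<sigma>)"
  \<comment> \<open>The part \<open>u\<close> of \<open>z(\<sigma>)\<close> lies in the range of \<open>U\<close>, so its multiple is absorbed by \<open>a\<close>.\<close>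
  define \<xi>0 where "\<xi>0 = a + ?H' \<cdot>\<^sub>v g"
  have \<xi>0: "\<xi>0 \<in> carrier_vec p" using a g by (simp add: \<xi>0_def)
  have "?U *\<^sub>v \<xi>0 + ?H' \<cdot>\<^sub>v v = ?U *\<^sub>v a + (?H' \<cdot>\<^sub>v u + ?H' \<cdot>\<^sub>v v)"
    unfolding \<xi>0_def g(2) using a g Uc v_carrier
    by (simp add: mult_add_distrib_mat_vec[OF Uc] mult_mat_vec[OF Uc] assoc_add_vec[of _ ?N])
  also have "\<dots> = bvec1 n H \<sigma>"
    unfolding eq t decomp using u v_carrier by (simp add: smult_add_distrib_vec[of _ ?N])
  finally have sol: "?eqn \<xi>0" unfolding mult[OF \<xi>0] bvec1_def .
  have gram: "?U\<^sup>T *\<^sub>v (?U *\<^sub>v \<xi>) = \<xi>" if "\<xi> \<in> carrier_vec p" for \<xi>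
    using that Uc
    by (simp add: assoc_mult_mat_vec[of _ p ?N _ p, symmetric]
        cmat_transpose_mult_self[OF U_carrier U_orthonormal])
  have unique: "\<xi> = \<xi>0" if \<xi>: "\<xi> \<in> carrier_vec p" and "?eqn \<xi>" for \<xi>
  proof -
    have sum: "?U *\<^sub>v \<xi> + ?H' \<cdot>\<^sub>v v = ?U *\<^sub>v \<xi>0 + ?H' \<cdot>\<^sub>v v"
      using that(2) sol unfolding mult[OF \<xi>] mult[OF \<xi>0] by simp
    have "?U *\<^sub>v \<xi> = ?U *\<^sub>v \<xi>0"
    proof (rule eq_vecI)
      fix i assume "i < dim_vec (?U *\<^sub>v \<xi>0)"
      then have i: "i < dim_vec (?H' \<cdot>\<^sub>v v)" using Uc v_carrier by simp
      show "(?U *\<^sub>v \<xi>) $ i = (?U *\<^sub>v \<xi>0) $ i"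
        using arg_cong[OF sum, of "\<lambda>x. x $ i"] unfolding index_add_vec(1)[OF i] by (rule add_right_imp_eq)
    qed simp
    then have "?U\<^sup>T *\<^sub>v (?U *\<^sub>v \<xi>) = ?U\<^sup>T *\<^sub>v (?U *\<^sub>v \<xi>0)" by (rule arg_cong)
    then show ?thesis unfolding gram[OF \<xi>] gram[OF \<xi>0] .
  qed
  have norms: "(vnorm \<xi>)\<^sup>2 + (cmod ?H')\<^sup>2 * \<alpha>\<^sup>2 * (vnorm (gam n \<sigma>))\<^sup>2
      = (1 + (cmod (H \<sigma>))\<^sup>2) * (vnorm (gam1 n \<sigma>))\<^sup>2"
    if \<xi>: "\<xi> \<in> carrier_vec p" and sol: "?eqn \<xi>" for \<xi>
  proof -
    have "(1 + (cmod (H \<sigma>))\<^sup>2) * (vnorm (gam1 n \<sigma>))\<^sup>2 = (vnorm (?U *\<^sub>v \<xi> + ?H' \<cdot>\<^sub>v v))\<^sup>2"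
      using sol unfolding mult[OF \<xi>] vnorm_bvec1[symmetric] bvec1_def by simp
    also have "\<dots> = (vnorm (?U *\<^sub>v \<xi>))\<^sup>2 + (vnorm (?H' \<cdot>\<^sub>v v))\<^sup>2"
      by (rule vnorm_add_orthogonal[of _ ?N])
        (use Uc \<xi> v_carrier orth[OF \<xi>] in \<open>auto simp: smult_scalar_prod_distrib[of _ ?N]\<close>)
    also have "\<dots> = (vnorm \<xi>)\<^sup>2 + (cmod ?H')\<^sup>2 * (vnorm v)\<^sup>2"
      by (simp add: vnorm_cmat_mult[OF U_carrier U_orthonormal \<xi>] vnorm_smult power_mult_distrib)
    also have "(vnorm v)\<^sup>2 = \<alpha>\<^sup>2 * (vnorm (gam n \<sigma>))\<^sup>2"
      using zpos by (simp add: \<alpha> vnorm_zvec power_divide)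
    finally show ?thesis by (simp add: mult.assoc)
  qed
  have formula: "\<alpha> = sqrt (((1 + (cmod (H \<sigma>))\<^sup>2) * (vnorm (gam1 n \<sigma>))\<^sup>2 - (vnorm \<xi>)\<^sup>2)
      / ((cmod ?H')\<^sup>2 * (vnorm (gam n \<sigma>))\<^sup>2))"
    if "\<xi> \<in> carrier_vec p" "?eqn \<xi>" "?H' \<noteq> 0" for \<xi>
  proof -
    have "((1 + (cmod (H \<sigma>))\<^sup>2) * (vnorm (gam1 n \<sigma>))\<^sup>2 - (vnorm \<xi>)\<^sup>2)
        / ((cmod ?H')\<^sup>2 * (vnorm (gam n \<sigma>))\<^sup>2) = \<alpha>\<^sup>2"
      unfolding norms[OF that(1,2), symmetric] using that(3) zpos by (simp add: vnorm_zvec)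
    moreover have "0 \<le> \<alpha>" unfolding \<alpha> using vpos zpos by simp
    ultimately show ?thesis by simp
  qed
  have "\<exists>!\<xi>. \<xi> \<in> carrier_vec p \<and> ?eqn \<xi>"
    using \<xi>0 sol unique by blast
  with \<theta>_pos \<theta>_le \<alpha> norms formula show ?thesis
    unfolding vnorm_zvec by blast
qed

end
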